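(* There exists a convex lattice polytope $\mathcal{P}$ such that $\mu_{midp}(\mathcal{P})<\mu_{Hilb}(\mathcal{P})<\mu_{idp}(\mathcal{P})$.
   Context: A lattice polytope $\mathcal{P}$ is normal in a lattice $M$ if for every positive integer $m$ every lattice point in $m\mathcal{P}$ is a sum of $m$ lattice points of $\mathcal{P}$. Let $\mathcal{C}\subset\mathbb{Z}\times M$ be the semigroup of lattice points in the real cone over $\{1\}\times\mathcal{P}$; the Hilbert basis of $\mathcal{P}$ is the minimum set of generators of $\mathcal{C}$ as a semigroup (it is finite), and the degree of a point of $\mathcal{C}$ is its coordinate in the first factor $\mathbb{Z}$. $\mu_{Hilb}(\mathcal{P})$ is the highest degree of an element of the Hilbert basis of $\mathcal{P}$. $\mu_{midp}(\mathcal{P})$ is the smallest positive integer $n$ such that $n\mathcal{P}$ is normal. $\mu_{idp}(\mathcal{P})$ is the smallest positive integer $N$ such that for every $n\ge N$ the polytope $n\mathcal{P}$ is normal. *)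

theory Defs
  imports "HOL-Analysis.Analysis" "HOL-Analysis.Finite_Function_Topology"
begin

text \<open>Lattices of finite rank, as subgroups of an ambient real vector space. The space of finitely
  supported functions from the naturals to the reals contains copies of the lattices of every
  finite rank, so quantifying over its lattices quantifies over the rank as well.\<close>

definition is_lattice :: "'a::real_vector set \<Rightarrow> bool" where
  "is_lattice M \<longleftrightarrow>
     (\<exists>B. finite B \<and> independent B \<and> M = {(\<Sum>b\<in>B. of_int (c b) *\<^sub>R b) |c :: 'a \<Rightarrow> int. True})"

definition lattice_polytope :: "'a::real_vector set \<Rightarrow> 'a set \<Rightarrow> bool" where
  "lattice_polytope M P \<longleftrightarrow> (\<exists>V. finite V \<and> V \<noteq> {} \<and> V \<subseteq> M \<and> P = convex hull V)"

definition dilate :: "nat \<Rightarrow> 'a::real_vector set \<Rightarrow> 'a set" where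
  "dilate n P = (\<lambda>x. real n *\<^sub>R x) ` P"

definition normal_polytope :: "'a::real_vector set \<Rightarrow> 'a set \<Rightarrow> bool" where
  "normal_polytope M P \<longleftrightarrow>
     (\<forall>m>0. \<forall>x \<in> dilate m P \<inter> M.
        \<exists>y :: nat \<Rightarrow> 'a. (\<forall>i<m. y i \<in> P \<inter> M) \<and> x = (\<Sum>i<m. y i))"

definition cone_semigroup :: "'a::real_vector set \<Rightarrow> 'a set \<Rightarrow> (int \<times> 'a) set" where
  "cone_semigroup M P =
     {(k, x). x \<in> M \<and> (real_of_int k, x) \<in> cone hull ({1 :: real} \<times> P)}"

definition additive_submonoid :: "'b::comm_monoid_add set \<Rightarrow> bool" where
  "additive_submonoid S \<longleftrightarrow> 0 \<in> S \<and> (\<forall>x\<in>S. \<forall>y\<in>S. x + y \<in> S)"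

text \<open>The minimum is taken with respect to inclusion. The semigroup of a nonempty polytope
  contains 0, and 0 is regarded as the empty sum of generators, so it is never an element of the
  Hilbert basis.\<close>

definition hilbert_basis :: "'a::real_vector set \<Rightarrow> 'a set \<Rightarrow> (int \<times> 'a) set" where
  "hilbert_basis M P = (LEAST G. additive_submonoid hull G = cone_semigroup M P)"

definition mu_Hilb :: "'a::real_vector set \<Rightarrow> 'a set \<Rightarrow> int" where
  "mu_Hilb M P = Max (fst ` hilbert_basis M P)"

definition mu_midp :: "'a::real_vector set \<Rightarrow> 'a set \<Rightarrow> nat" where
  "mu_midp M P = (LEAST n. n > 0 \<and> normal_polytope M (dilate n P))"

definition mu_idp :: "'a::real_vector set \<Rightarrow> 'a set \<Rightarrow> nat" where
  "mu_idp M P = (LEAST N. N > 0 \<and> (\<forall>n\<ge>N. normal_polytope M (dilate n P)))"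

end

theory Submission
  imports Defs
begin

text \<open>
  The example is a product \<open>P = P\<^sub>1 \<times> P\<^sub>2\<close> of two simplices with respect to a refined lattice, with
  \<open>mu_midp \<le> 4\<close>, \<open>mu_Hilb = 5\<close> and \<open>mu_idp \<ge> 6\<close>.

  The building block is the lattice of integer vectors on \<open>2h\<close> coordinates whose entries are all even
  or all odd, together with the simplex of nonnegative vectors with coordinate sum 2. Its vertices
  are the vectors \<open>2e\<^sub>i\<close>, the degree of a point is half its coordinate sum, and the semigroup is
  generated by the vertices (degree 1) and by the all-ones vector, of degree \<open>h\<close>, which cannot be
  decomposed. Joining such blocks with half-sizes \<open>h\<^sub>1, \<dots>, h\<^sub>r\<close> gives a simplex whose lattice points
  are sums of distinct all-ones vectors of blocks and of vertices. For these the possible degrees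
  of a summand are essentially subset sums of a multiset of half-sizes and ones.

  Take half-sizes 4, 4, 2 for \<open>P\<^sub>1\<close> and 2, 3 for \<open>P\<^sub>2\<close>. A point of degree \<open>k\<close> over \<open>P\<close> is a pair of
  points of degree \<open>k\<close> over \<open>P\<^sub>1\<close> and \<open>P\<^sub>2\<close>; a decomposition of the pair has to split both components
  in the same degrees. Four computations give the theorem.

  \<^item> From degree 6 on, a summand of degree 4 can always be split off
    (\<open>parity_vectors_split_4\<close>): over \<open>P\<^sub>1\<close> it is a block of half-size 4, over \<open>P\<^sub>2\<close> it is the block of
    half-size 3 and a vertex, and if the block is not available there are four vertices. Hence
    \<open>4P\<close> is normal, and no element of the Hilbert basis has degree above 5.

  \<^item> In degree 5, the pair of (block 4 + vertex) and (block 2 + block 3) is indecomposable: the first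
    component splits only as 1 + 4, the second only as 2 + 3 (\<open>degree_of_summand\<close>).

  \<^item> In degree 10, the point (block 4 + block 4 + block 2) over \<open>P\<^sub>1\<close> has only summands of even
    degree, so \<open>5P\<close> is not normal (\<open>not_normal_dilate_5\<close>).

  \<^item> If \<open>n \<ge> 10\<close>, points of degree at least \<open>2n\<close> involve at least \<open>n\<close> vertices over each factor, so that
    \<open>nP\<close> is normal (\<open>normal_dilate_large\<close>). This makes \<open>mu_idp\<close> a minimum over a nonempty set, and the
    failure of normality of \<open>5P\<close> bounds it from below.
\<close>

section \<open>Dilations and Hilbert bases in terms of graded pieces\<close>

definition level :: "'a::real_vector set \<Rightarrow> 'a set \<Rightarrow> nat \<Rightarrow> 'a set" where
  "level M P k = dilate k P \<inter> M"

lemma dilate_dilate: "dilate m (dilate n P) = dilate (m * n) P"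
  by (auto simp: dilate_def image_image)

lemma normal_dilate_iff:
  "normal_polytope M (dilate n P) \<longleftrightarrow>
     (\<forall>m>0. \<forall>x \<in> level M P (m * n).
        \<exists>y :: nat \<Rightarrow> 'a. (\<forall>i<m. y i \<in> level M P n) \<and> x = (\<Sum>i<m. y i))"
  for M :: "'a::real_vector set"
  by (simp add: normal_polytope_def dilate_dilate level_def)

text \<open>Splitting off one summand of degree \<open>n\<close> suffices, since the rest has degree \<open>(m - 1)n\<close> and
  induction applies until degree \<open>n\<close> is reached.\<close>

lemma normal_dilateI:
  fixes M :: "'a::real_vector set"
  assumes split: "\<And>k x. 2 * n \<le> k \<Longrightarrow> x \<in> level M P k \<Longrightarrow>
                    \<exists>y \<in> level M P n. x - y \<in> level M P (k - n)"
  shows "normal_polytope M (dilate n P)"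
proof -
  have "\<exists>y :: nat \<Rightarrow> 'a. (\<forall>i<Suc m. y i \<in> level M P n) \<and> x = (\<Sum>i<Suc m. y i)"
    if "x \<in> level M P (Suc m * n)" for m x
    using that
  proof (induction m arbitrary: x)
    case 0
    then show ?case by (intro exI[of _ "\<lambda>_. x"]) simp
  next
    case (Suc m)
    obtain z where z: "z \<in> level M P n" "x - z \<in> level M P (Suc (Suc m) * n - n)"
      using split[OF _ Suc.prems] by auto
    then have "x - z \<in> level M P (Suc m * n)" by simp
    from Suc.IH[OF this] obtain y
      where y: "\<forall>i<Suc m. y i \<in> level M P n" "x - z = (\<Sum>i<Suc m. y i)"
      by blast
    have "x = (\<Sum>i<Suc (Suc m). (y(Suc m := z)) i)"
      using y(2) by (simp add: algebra_simps)
    moreover have "\<forall>i<Suc (Suc m). (y(Suc m := z)) i \<in> level M P n"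
      using y(1) z(1) by (simp add: less_Suc_eq)
    ultimately show ?case by blast
  qed
  then show ?thesis
    unfolding normal_dilate_iff by (metis gr0_implies_Suc)
qed

lemma cone_semigroup_eq: "cone_semigroup M P = {(int k, x) |k x. x \<in> level M P k}"
proof -
  have "(real_of_int k, x) \<in> cone hull ({1::real} \<times> P) \<longleftrightarrow> 0 \<le> k \<and> x \<in> dilate (nat k) P" for k x
    by (force simp: cone_hull_expl dilate_def)
  then show ?thesis
    by (force simp: cone_semigroup_def level_def)
qed

lemma mem_cone_semigroup_iff:
  "(k, x) \<in> cone_semigroup M P \<longleftrightarrow> (\<exists>n. k = int n \<and> x \<in> level M P n)"
  by (simp add: cone_semigroup_eq)

definition irreducibles :: "'b::comm_monoid_add set \<Rightarrow> 'b set" where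
  "irreducibles S = {s \<in> S. s \<noteq> 0 \<and> (\<forall>a\<in>S. \<forall>b\<in>S. s = a + b \<longrightarrow> a = 0 \<or> b = 0)}"

lemma additive_submonoid_hull: "additive_submonoid (additive_submonoid hull G)"
  by (rule hull_in) (auto simp: additive_submonoid_def)

text \<open>An irreducible element lies in every generating set, because removing it leaves a submonoid.
  Conversely the irreducible elements generate, by induction on the degree, which is positive
  away from 0. So they form the least generating set.\<close>

lemma hilbert_basis_eq_irreducibles:
  fixes M :: "'a::real_vector set"
  assumes mon: "additive_submonoid (cone_semigroup M P)"
    and deg: "\<And>k x. (k, x) \<in> cone_semigroup M P \<Longrightarrow> 0 \<le> k \<and> (k = 0 \<longrightarrow> x = 0)"
  shows "hilbert_basis M P = irreducibles (cone_semigroup M P)"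
  unfolding hilbert_basis_def
proof (rule Least_equality)
  let ?S = "cone_semigroup M P" and ?H = "irreducibles (cone_semigroup M P)"
  have "s \<in> additive_submonoid hull ?H" if "s \<in> ?S" for s
    using that
  proof (induction "nat (fst s)" arbitrary: s rule: less_induct)
    case less
    have pos: "fst t > 0" if "t \<in> ?S" "t \<noteq> 0" for t
      using deg[of "fst t" "snd t"] that by (metis order_le_less prod.collapse zero_prod_def)
    consider "s = 0" | "s \<in> ?H" | a b where "a \<in> ?S" "b \<in> ?S" "a \<noteq> 0" "b \<noteq> 0" "s = a + b"
      using less.prems unfolding irreducibles_def by blast
    then show ?case
    proof cases
      case 1
      then show ?thesis
        using additive_submonoid_hull[of ?H] by (simp add: additive_submonoid_def)
    next
      case 2
      then show ?thesis by (rule hull_inc)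
    next
      case 3
      then have "a \<in> additive_submonoid hull ?H" "b \<in> additive_submonoid hull ?H"
        using pos[of a] pos[of b] by (simp_all add: less.hyps)
      then show ?thesis
        using additive_submonoid_hull[of ?H] 3(5) by (simp add: additive_submonoid_def)
    qed
  qed
  moreover have "additive_submonoid hull ?H \<subseteq> ?S"
    by (rule hull_minimal) (auto simp: irreducibles_def mon)
  ultimately show "additive_submonoid hull ?H = ?S" by blast
next
  fix G
  assume G: "additive_submonoid hull G = cone_semigroup M P"
  let ?S = "cone_semigroup M P"
  show "irreducibles ?S \<subseteq> G"
  proof
    fix h assume h: "h \<in> irreducibles ?S"
    show "h \<in> G"
    proof (rule ccontr)
      assume "h \<notin> G"
      then have "G \<subseteq> ?S - {h}" using G hull_subset[of G additive_submonoid] by auto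
      moreover have "additive_submonoid (?S - {h})"
        unfolding additive_submonoid_def
      proof (intro conjI ballI)
        show "0 \<in> ?S - {h}"
          using mon h by (simp add: additive_submonoid_def irreducibles_def)
        fix a b assume ab: "a \<in> ?S - {h}" "b \<in> ?S - {h}"
        have "h \<noteq> a + b"
        proof
          assume "h = a + b"
          then have "a = 0 \<or> b = 0" using h ab unfolding irreducibles_def by blast
          then show False using \<open>h = a + b\<close> ab by auto
        qed
        then show "a + b \<in> ?S - {h}"
          using mon ab by (simp add: additive_submonoid_def)
      qed
      ultimately have "additive_submonoid hull G \<subseteq> ?S - {h}" by (rule hull_minimal)
      then show False using G h by (auto simp: irreducibles_def)
    qed
  qed
qed

section \<open>The lattice of parity vectors\<close>

text \<open>The construction uses \<open>30 = 2 (4 + 4 + 2) + 2 (2 + 3)\<close> coordinates; the first 20 belong to the first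
  factor and the last 10 to the second.\<close>

definition of_coords :: "(nat \<Rightarrow> real) \<Rightarrow> (nat \<Rightarrow>\<^sub>0 real)" where
  "of_coords f = (\<Sum>i<30. Poly_Mapping.single i (f i))"

lemma lookup_of_coords: "Poly_Mapping.lookup (of_coords f) i = (if i < 30 then f i else 0)"
  by (auto simp: of_coords_def lookup_sum lookup_single when_def)

lemma lookup_scale: "Poly_Mapping.lookup (c *\<^sub>R x) i = c * Poly_Mapping.lookup x i"
  for x :: "nat \<Rightarrow>\<^sub>0 real"
proof -
  have "finite {i. c * Poly_Mapping.lookup x i \<noteq> 0}"
    by (rule finite_subset[OF _ finite_lookup[of x]]) auto
  then show ?thesis by (simp add: scaleR_poly_mapping_def)
qed

lemma of_coords_eq_iff: "of_coords f = of_coords g \<longleftrightarrow> (\<forall>i<30. f i = g i)"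
  by (auto simp: poly_mapping_eq_iff fun_eq_iff lookup_of_coords)

lemma of_coords_zero_iff: "of_coords f = 0 \<longleftrightarrow> (\<forall>i<30. f i = 0)"
  by (auto simp: poly_mapping_eq_iff fun_eq_iff lookup_of_coords)

lemma of_coords_add: "of_coords f + of_coords g = of_coords (\<lambda>i. f i + g i)"
  by (auto simp: poly_mapping_eq_iff fun_eq_iff lookup_of_coords lookup_add)

lemma of_coords_scale: "c *\<^sub>R of_coords f = of_coords (\<lambda>i. c * f i)"
  by (auto simp: poly_mapping_eq_iff fun_eq_iff lookup_of_coords lookup_scale)

lemma of_coords_sum: "(\<Sum>j\<in>A. of_coords (f j)) = of_coords (\<lambda>i. \<Sum>j\<in>A. f j i)"
  by (auto simp: poly_mapping_eq_iff fun_eq_iff lookup_of_coords lookup_sum)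

text \<open>The coordinates fall into blocks of sizes 8, 8, 4 and 4, 6. A block is represented by its least
  index, so that "constant on blocks" becomes invariance under \<open>block_start\<close>.\<close>

definition block_start :: "nat \<Rightarrow> nat" where
  "block_start i = (if i < 8 then 0 else if i < 16 then 8 else if i < 20 then 16
             else if i < 24 then 20 else 24)"

definition parity_lattice :: "(nat \<Rightarrow>\<^sub>0 real) set" where
  "parity_lattice =
     {of_coords (\<lambda>i. of_int (c i)) |c :: nat \<Rightarrow> int. \<forall>i<30. even (c i) = even (c (block_start i))}"

lemma block_start_idem: "block_start (block_start i) = block_start i"
  and block_start_less: "i < 30 \<Longrightarrow> block_start i < 30"
  by (simp_all add: block_start_def)

lemma is_lattice_of_family:
  fixes b :: "'i \<Rightarrow> 'a::real_vector"
  assumes "finite I"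
    and indep: "\<And>c. (\<Sum>i\<in>I. c i *\<^sub>R b i) = 0 \<Longrightarrow> \<forall>i\<in>I. c i = 0"
  shows "is_lattice {(\<Sum>i\<in>I. of_int (c i) *\<^sub>R b i) |c. True}"
proof -
  have inj: "inj_on b I"
  proof (rule inj_onI, rule ccontr)
    fix i j assume ij: "i \<in> I" "j \<in> I" "b i = b j" "i \<noteq> j"
    have "(\<Sum>k\<in>I. ((if k = i then 1 else 0) - (if k = j then 1 else 0)) *\<^sub>R b k) = 0"
      using ij assms(1)
      by (simp add: scaleR_diff_left sum_subtractf if_distrib[of "\<lambda>c. c *\<^sub>R _"] cong: if_cong)
    from indep[OF this] ij show False by auto
  qed
  have "independent (b ` I)"
    unfolding dependent_finite[OF finite_imageI[OF assms(1)]]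
    using indep by (force simp: sum.reindex[OF inj])
  moreover have "{(\<Sum>i\<in>I. of_int (c i) *\<^sub>R b i) |c. True} =
                 {(\<Sum>v\<in>b ` I. of_int (c v) *\<^sub>R v) |c. True}" (is "?L = ?R")
  proof
    show "?R \<subseteq> ?L" by (auto simp: sum.reindex[OF inj])
    show "?L \<subseteq> ?R"
    proof clarify
      fix c :: "'i \<Rightarrow> int"
      show "\<exists>d. (\<Sum>i\<in>I. of_int (c i) *\<^sub>R b i) = (\<Sum>v\<in>b ` I. of_int (d v) *\<^sub>R v) \<and> True"
        by (rule exI[of _ "\<lambda>v. c (the_inv_into I b v)"])
          (simp add: sum.reindex[OF inj] the_inv_into_f_f[OF inj])
    qed
  qed
  ultimately show ?thesis
    unfolding is_lattice_def using assms(1) by blast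
qed

text \<open>A basis consists of the all-ones vectors of the blocks, indexed by the least elements of the blocks,
  and of the vectors \<open>2e\<^sub>j\<close> for all other indices \<open>j\<close>. The coefficients can be read off in this order:
  the coordinate at the least element of a block is the coefficient of the all-ones vector.\<close>

lemma is_lattice_parity_lattice: "is_lattice parity_lattice"
proof -
  define b where "b i = of_coords (\<lambda>j. (if block_start j = i then 1 else 0) +
                                 (if j = i then if block_start j \<noteq> j then 2 else 0 else 0))" for i
  have comb: "(\<Sum>i<30. c i *\<^sub>R b i) = of_coords (\<lambda>j. c (block_start j) + (if block_start j \<noteq> j then 2 * c j else 0))" for c
  proof -
    have "(\<Sum>i<30. c i * ((if block_start j = i then 1 else 0) + (if j = i then if block_start j \<noteq> j then 2 else 0 else 0)))
          = c (block_start j) + (if block_start j \<noteq> j then 2 * c j else 0)" (is "?l = _") if "j < 30" for j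
    proof -
      have "?l = (\<Sum>i<30. (if block_start j = i then c i else 0) +
                         (if j = i then if block_start j \<noteq> j then 2 * c j else 0 else 0))"
        by (rule sum.cong) auto
      then show ?thesis
        using that block_start_less[OF that] by (simp only: sum.distrib sum.delta' finite_lessThan lessThan_iff if_True)
    qed
    then show ?thesis unfolding b_def of_coords_scale of_coords_sum of_coords_eq_iff by blast
  qed
  have "is_lattice {(\<Sum>i<30. of_int (c i) *\<^sub>R b i) |c. True}"
  proof (rule is_lattice_of_family)
    fix c :: "nat \<Rightarrow> real"
    assume "(\<Sum>i<30. c i *\<^sub>R b i) = 0"
    then have eq: "c (block_start j) + (if block_start j \<noteq> j then 2 * c j else 0) = 0" if "j < 30" for j
      using that by (simp add: comb of_coords_zero_iff)
    show "\<forall>i\<in>{..<30}. c i = 0"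
    proof
      fix i :: nat assume "i \<in> {..<30}"
      then have i: "i < 30" by simp
      have "c (block_start i) = 0"
        using eq[OF block_start_less[OF i]] by (simp add: block_start_idem)
      then show "c i = 0"
        using eq[OF i] by (cases "block_start i = i") simp_all
    qed
  qed simp
  also have "{(\<Sum>i<30. of_int (c i) *\<^sub>R b i) |c. True} = parity_lattice" (is "?L = _")
  proof
    show "?L \<subseteq> parity_lattice"
    proof clarify
      fix c :: "nat \<Rightarrow> int"
      show "(\<Sum>i<30. of_int (c i) *\<^sub>R b i) \<in> parity_lattice"
        unfolding parity_lattice_def comb
        by (rule CollectI, rule exI[of _ "\<lambda>j. c (block_start j) + (if block_start j \<noteq> j then 2 * c j else 0)"])
          (auto simp: of_coords_eq_iff block_start_idem)
    qed
    show "parity_lattice \<subseteq> ?L"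
    proof
      fix x assume "x \<in> parity_lattice"
      then obtain d :: "nat \<Rightarrow> int"
        where d: "x = of_coords (\<lambda>i. of_int (d i))" "\<forall>i<30. even (d i) = even (d (block_start i))"
        by (auto simp: parity_lattice_def)
      define c where "c i = (if block_start i = i then d i else (d i - d (block_start i)) div 2)" for i
      have "d j = c (block_start j) + (if block_start j \<noteq> j then 2 * c j else 0)" if "j < 30" for j
        using d(2) that by (auto simp: c_def block_start_idem)
      then have "x = (\<Sum>i<30. of_int (c i) *\<^sub>R b i)"
        unfolding d(1) comb of_coords_eq_iff by simp
      then show "x \<in> ?L" by blast
    qed
  qed
  finally show ?thesis .
qed

section \<open>The polytope\<close>

text \<open>The vertices of a product are pairs of vertices; here \<open>i\<close> belongs to the first factor and \<open>j\<close> to the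
  second.\<close>

definition simplex_product :: "(nat \<Rightarrow>\<^sub>0 real) set" where
  "simplex_product = convex hull ((\<lambda>(i, j). of_coords (\<lambda>k. (if k = i then 2 else 0) + (if k = j then 2 else 0)))
                         ` ({..<20} \<times> {20..<30}))"

lemma lattice_polytope_simplex_product: "lattice_polytope parity_lattice simplex_product"
  unfolding lattice_polytope_def simplex_product_def
proof (intro exI conjI)
  show "(\<lambda>(i, j). of_coords (\<lambda>k. (if k = i then 2 else 0) + (if k = j then 2 else 0)))
                         ` ({..<20} \<times> {20..<30}) \<subseteq> parity_lattice"
    unfolding parity_lattice_def
  proof clarify
    fix i j :: nat
    show "\<exists>c. of_coords (\<lambda>k. (if k = i then 2 else 0) + (if k = j then 2 else 0)) = of_coords (\<lambda>i. of_int (c i)) \<and>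
           (\<forall>i<30. even (c i) = even (c (block_start i)))"
      by (rule exI[of _ "\<lambda>k. (if k = i then 2 else 0) + (if k = j then 2 else 0)"])
        (auto simp: of_coords_eq_iff)
  qed
  have "(0, 20) \<in> {..<20::nat} \<times> {20..<30::nat}" by simp
  then show "(\<lambda>(i, j). of_coords (\<lambda>k. (if k = i then 2 else 0) + (if k = j then 2 else 0)))
                         ` ({..<20} \<times> {20..<30}) \<noteq> {}" by blast
qed auto

lemma simplex_product_nonempty: "simplex_product \<noteq> {}"
  using lattice_polytope_simplex_product by (metis convex_hull_eq_empty lattice_polytope_def)

text \<open>A pair of points of the two factors is the convex combination of pairs of vertices whose
  coefficients are the products of the barycentric coordinates \<open>f i / 2\<close> and \<open>f j / 2\<close>.\<close>

lemma simplex_product_eq: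
  "simplex_product = {of_coords f |f. (\<forall>i. 0 \<le> f i) \<and> (\<Sum>i<20. f i) = 2 \<and> (\<Sum>i=20..<30. f i) = 2}" (is "_ = ?R")
proof
  have "convex ?R"
  proof (rule convexI)
    fix x y and u v :: real
    assume "x \<in> ?R" "y \<in> ?R" and uv: "0 \<le> u" "0 \<le> v" "u + v = 1"
    then obtain f g where f: "x = of_coords f" "\<forall>i. 0 \<le> f i" "(\<Sum>i<20. f i) = 2" "(\<Sum>i=20..<30. f i) = 2"
      and g: "y = of_coords g" "\<forall>i. 0 \<le> g i" "(\<Sum>i<20. g i) = 2" "(\<Sum>i=20..<30. g i) = 2"
      by auto
    show "u *\<^sub>R x + v *\<^sub>R y \<in> ?R"
      by (rule CollectI, rule exI[of _ "\<lambda>i. u * f i + v * g i"])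
        (use f g uv in \<open>simp add: of_coords_scale of_coords_add sum.distrib flip: sum_distrib_left distrib_right\<close>)
  qed
  then show "simplex_product \<subseteq> ?R"
    unfolding simplex_product_def by (intro hull_minimal) (auto intro!: exI[of _ "\<lambda>k. (if k = _ then 2 else 0) + (if k = _ then 2 else 0)"] simp: sum.distrib)
  show "?R \<subseteq> simplex_product"
  proof clarify
    fix f :: "nat \<Rightarrow> real"
    assume f: "\<forall>i. 0 \<le> f i" "(\<Sum>i<20. f i) = 2" "(\<Sum>i=20..<30. f i) = 2"
    let ?I = "{..<20} \<times> {20..<30::nat}"
    let ?v = "\<lambda>(i, j). of_coords (\<lambda>k. (if k = i then 2 else 0) + (if k = j then 2 else 0))"
    let ?a = "\<lambda>(i, j). f i * f j / 4"
    have "(\<Sum>p\<in>?I. ?a p) = (\<Sum>i<20. \<Sum>j=20..<30. f i * f j / 4)"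
      by (simp add: sum.cartesian_product)
    also have "\<dots> = (\<Sum>i<20. f i) * (\<Sum>j=20..<30. f j) / 4"
      by (simp only: sum_product sum_divide_distrib)
    finally have one: "(\<Sum>p\<in>?I. ?a p) = 1"
      using f by simp
    have "(\<Sum>p\<in>?I. ?a p *\<^sub>R ?v p) \<in> simplex_product"
      unfolding simplex_product_def
    proof (rule convex_sum)
      show "(\<Sum>p\<in>?I. ?a p) = 1" by (rule one)
    qed (auto intro!: hull_inc simp: f(1))
    also have "(\<Sum>p\<in>?I. ?a p *\<^sub>R ?v p) =
      of_coords (\<lambda>k. \<Sum>i<20. \<Sum>j=20..<30. f i * f j / 4 * ((if k = i then 2 else 0) + (if k = j then 2 else 0)))"
      by (simp add: case_prod_beta of_coords_scale of_coords_sum sum.cartesian_product)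
    also have "\<dots> = of_coords f"
      unfolding of_coords_eq_iff
    proof (intro allI impI)
      fix k :: nat assume k: "k < 30"
      have "(\<Sum>i<20. \<Sum>j=20..<30. f i * f j / 4 * ((if k = i then 2 else 0) + (if k = j then 2 else 0)))
          = (\<Sum>i<20. if k = i then f i else 0) * (\<Sum>j=20..<30. f j / 2)
            + (\<Sum>i<20. f i / 2) * (\<Sum>j=20..<30. if k = j then f j else 0)"
        unfolding sum_product sum.distrib[symmetric] by (intro sum.cong refl) simp
      also have "\<dots> = f k"
        using k f(2,3) by (simp flip: sum_divide_distrib)
      finally show "(\<Sum>i<20. \<Sum>j=20..<30. f i * f j / 4 * ((if k = i then 2 else 0) + (if k = j then 2 else 0))) = f k" .
    qed
    finally show "of_coords f \<in> simplex_product" .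
  qed
qed

text \<open>Lattice points in the dilations of the polytope have natural coordinates, which allows the
  combinatorial part to be carried out with functions into the naturals. Values at indices from 30 on
  carry no information.\<close>

definition parity_vectors :: "nat \<Rightarrow> (nat \<Rightarrow> nat) set" where
  "parity_vectors k = {f. (\<forall>i<30. even (f i) = even (f (block_start i))) \<and>
                  (\<Sum>i<20. f i) = 2 * k \<and> (\<Sum>i=20..<30. f i) = 2 * k}"

lemma level_simplex_product: "level parity_lattice simplex_product k = {of_coords (\<lambda>i. real (f i)) |f. f \<in> parity_vectors k}"
proof (intro equalityI subsetI)
  fix x assume "x \<in> level parity_lattice simplex_product k"
  then have "x \<in> dilate k simplex_product" "x \<in> parity_lattice" by (simp_all add: level_def)
  then obtain f :: "nat \<Rightarrow> real" and c :: "nat \<Rightarrow> int"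
    where f: "x = real k *\<^sub>R of_coords f" "\<forall>i. 0 \<le> f i" "(\<Sum>i<20. f i) = 2" "(\<Sum>i=20..<30. f i) = 2"
      and c: "x = of_coords (\<lambda>i. of_int (c i))" "\<forall>i<30. even (c i) = even (c (block_start i))"
    unfolding dilate_def simplex_product_eq parity_lattice_def by blast
  define g where "g i = nat (c i)" for i
  have eq: "real_of_int (c i) = real k * f i" if "i < 30" for i
    using f(1) c(1) that by (simp add: of_coords_scale of_coords_eq_iff)
  have cg: "c i = int (g i)" if "i < 30" for i
  proof -
    have "0 \<le> real_of_int (c i)" using eq[OF that] f(2) by simp
    then show ?thesis by (simp add: g_def)
  qed
  have gf: "real (g i) = real k * f i" if "i < 30" for i
    using eq[OF that] cg[OF that] by simp
  have "(\<Sum>i<20. real (g i)) = real (2 * k)"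
    using f(3) by (simp add: gf flip: sum_distrib_left)
  moreover have "(\<Sum>i=20..<30. real (g i)) = real (2 * k)"
    using f(4) by (simp add: gf flip: sum_distrib_left)
  ultimately have "g \<in> parity_vectors k"
    using c(2) by (simp add: parity_vectors_def cg block_start_less flip: of_nat_sum)
  moreover have "x = of_coords (\<lambda>i. real (g i))"
    by (simp add: c(1) of_coords_eq_iff cg)
  ultimately show "x \<in> {of_coords (\<lambda>i. real (f i)) |f. f \<in> parity_vectors k}" by blast
next
  fix x assume "x \<in> {of_coords (\<lambda>i. real (f i)) |f. f \<in> parity_vectors k}"
  then obtain f where x: "x = of_coords (\<lambda>i. real (f i))"
    and f: "\<forall>i<30. even (f i) = even (f (block_start i))" "(\<Sum>i<20. f i) = 2 * k" "(\<Sum>i=20..<30. f i) = 2 * k"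
    by (auto simp: parity_vectors_def)
  have "x \<in> parity_lattice"
    unfolding parity_lattice_def x
    by (rule CollectI, rule exI[of _ "\<lambda>i. int (f i)"]) (use f in simp)
  moreover have "x \<in> dilate k simplex_product"
  proof (cases "k = 0")
    case True
    have "f i = 0" if "i < 30" for i
      using f(2,3) that True by (cases "i < 20") auto
    then have "x = 0" by (simp add: x of_coords_zero_iff)
    moreover have "simplex_product \<noteq> {}"
      by (rule simplex_product_nonempty)
    ultimately show ?thesis using True by (auto simp: dilate_def)
  next
    case False
    have "(\<Sum>i<20. real (f i) / real k) = 2" "(\<Sum>i=20..<30. real (f i) / real k) = 2"
      using f False by (simp_all flip: sum_divide_distrib of_nat_sum)
    then have "of_coords (\<lambda>i. real (f i) / real k) \<in> simplex_product"
      unfolding simplex_product_eq by (intro CollectI exI conjI allI) (auto)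
    moreover have "x = real k *\<^sub>R of_coords (\<lambda>i. real (f i) / real k)"
      using False by (simp add: x of_coords_scale)
    ultimately show ?thesis by (auto simp: dilate_def)
  qed
  ultimately show "x \<in> level parity_lattice simplex_product k" by (simp add: level_def)
qed

lemma of_coords_mem_level: "f \<in> parity_vectors k \<Longrightarrow> of_coords (\<lambda>i. real (f i)) \<in> level parity_lattice simplex_product k"
  by (auto simp: level_simplex_product)

section \<open>Splitting off elements\<close>

lemma nat_function_below_with_sum:
  fixes u :: "'a \<Rightarrow> nat"
  assumes "finite X" "r \<le> sum u X"
  shows "\<exists>v. (\<forall>i. v i \<le> u i) \<and> sum v X = r"
  using assms
proof (induction X arbitrary: r rule: finite_induct)
  case empty
  then show ?case by auto
next
  case (insert x X)
  have "r - min r (u x) \<le> sum u X" using insert by auto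
  then obtain v where v: "\<forall>i. v i \<le> u i" "sum v X = r - min r (u x)"
    using insert.IH by blast
  have "sum (v(x := min r (u x))) X = sum v X"
    using insert.hyps by (intro sum.cong) auto
  then show ?case
    using v insert.hyps by (intro exI[of _ "v(x := min r (u x))"]) auto
qed

text \<open>Counts the vertices available in a vector: besides the all-ones part on its odd entries it
  contains \<open>f i div 2\<close> copies of \<open>2e\<^sub>i\<close>.\<close>

lemma twice_sum_div2:
  fixes f :: "'a \<Rightarrow> nat"
  assumes "finite X"
  shows "2 * (\<Sum>i\<in>X. f i div 2) + card {i \<in> X. odd (f i)} = sum f X"
proof -
  have "card {i \<in> X. odd (f i)} = (\<Sum>i\<in>{i \<in> X. odd (f i)}. 1)"
    by simp
  also have "\<dots> = (\<Sum>i\<in>X. if odd (f i) then 1 else 0)"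
    by (rule sum.inter_filter[OF assms])
  also have "\<dots> = (\<Sum>i\<in>X. f i mod 2)"
    by (rule sum.cong) (auto simp: odd_iff_mod_2_eq_one)
  finally show ?thesis
    by (simp add: sum_distrib_left flip: sum.distrib)
qed

text \<open>The general way to split off a summand of degree \<open>d\<close>: take the all-ones vectors of a union \<open>A\<close> of blocks on
  which \<open>f\<close> is odd, and fill up with \<open>r1\<close> vertices of the first and \<open>r2\<close> vertices of the second
  factor.\<close>

lemma parity_vectors_split:
  assumes f: "f \<in> parity_vectors k"
    and A: "\<forall>i\<in>A. odd (f i)" "\<forall>i<30. block_start i \<in> A \<longleftrightarrow> i \<in> A"
    and r1: "card (A \<inter> {..<20}) + 2 * r1 = 2 * d" "r1 \<le> (\<Sum>i<20. f i div 2)"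
    and r2: "card (A \<inter> {20..<30}) + 2 * r2 = 2 * d" "r2 \<le> (\<Sum>i=20..<30. f i div 2)"
  shows "\<exists>g \<in> parity_vectors d. (\<lambda>i. f i - g i) \<in> parity_vectors (k - d) \<and> (\<forall>i. g i \<le> f i)"
proof -
  obtain u1 where u1: "\<forall>i. u1 i \<le> f i div 2" "(\<Sum>i<20. u1 i) = r1"
    using nat_function_below_with_sum[OF _ r1(2)] by auto
  obtain u2 where u2: "\<forall>i. u2 i \<le> f i div 2" "(\<Sum>i=20..<30. u2 i) = r2"
    using nat_function_below_with_sum[OF _ r2(2)] by auto
  define g where "g i = (if i \<in> A then 1 else 0) + 2 * (if i < 20 then u1 i else u2 i)" for i
  have le: "g i \<le> f i" for i
  proof -
    have "(if i \<in> A then 1 else 0) \<le> f i mod 2"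
      using A(1) by (auto simp: odd_iff_mod_2_eq_one)
    moreover have "(if i < 20 then u1 i else u2 i) \<le> f i div 2" using u1 u2 by simp
    moreover have "f i mod 2 + 2 * (f i div 2) = f i" by simp
    ultimately show ?thesis unfolding g_def by linarith
  qed
  have par: "even (g i) = even (g (block_start i))" if "i < 30" for i
    using A(2) that by (simp add: g_def)
  have s1: "(\<Sum>i<20. g i) = 2 * d"
    using r1(1) u1(2) by (simp add: g_def sum.distrib sum.If_cases Int_commute flip: sum_distrib_left)
  have "(\<Sum>i=20..<30. g i) = (\<Sum>i=20..<30. (if i \<in> A then 1 else 0)) + 2 * (\<Sum>i=20..<30. u2 i)"
    by (simp add: g_def sum.distrib sum_distrib_left)
  then have s2: "(\<Sum>i=20..<30. g i) = 2 * d"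
    using r2(1) u2(2) by (simp add: sum.If_cases Int_commute)
  have "g \<in> parity_vectors d" using par s1 s2 by (simp add: parity_vectors_def)
  moreover have "(\<lambda>i. f i - g i) \<in> parity_vectors (k - d)"
    unfolding parity_vectors_def
  proof (intro CollectI conjI allI impI)
    fix i :: nat assume "i < 30"
    then have "even (f i) = even (f (block_start i))" "even (g i) = even (g (block_start i))"
      using f par by (simp_all add: parity_vectors_def)
    then show "even (f i - g i) = even (f (block_start i) - g (block_start i))"
      using le[of i] le[of "block_start i"] by simp
  qed (use f s1 s2 le in \<open>simp_all add: parity_vectors_def sum_subtractf_nat\<close>)
  ultimately show ?thesis using le by blast
qed

text \<open>If neither block of size 8 is odd, at most the four entries of the third block are odd, and likewise
  in the second factor if the block of size 6 is even. So at least \<open>(12 - 4) / 2\<close> vertices are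
  available. If the block of size 6 is odd, it has degree 3, and since the
  all-ones vectors of the second factor account for degree at most 5, degree 6 leaves a vertex to
  complete it to degree 4.\<close>

lemma parity_vectors_split_4:
  assumes f: "f \<in> parity_vectors k" and k: "6 \<le> k"
  shows "\<exists>g \<in> parity_vectors 4. (\<lambda>i. f i - g i) \<in> parity_vectors (k - 4) \<and> (\<forall>i. g i \<le> f i)"
proof -
  have par: "even (f i) = even (f (block_start i))" if "i < 30" for i
    using f that by (simp add: parity_vectors_def)
  have block0: "even (f i) = even (f 0)" if "i < 8" for i
    using par[of i] that by (simp add: block_start_def)
  have block8: "even (f i) = even (f 8)" if "8 \<le> i" "i < 16" for i
    using par[of i] that by (simp add: block_start_def)
  have block24: "even (f i) = even (f 24)" if "24 \<le> i" "i < 30" for i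
    using par[of i] that by (simp add: block_start_def)
  have sums: "(\<Sum>i<20. f i) = 2 * k" "(\<Sum>i=20..<30. f i) = 2 * k"
    using f by (simp_all add: parity_vectors_def)
  have "\<exists>A1 r1. A1 \<subseteq> {..<20} \<and> (\<forall>i\<in>A1. odd (f i)) \<and> (\<forall>i<30. block_start i \<in> A1 \<longleftrightarrow> i \<in> A1) \<and>
     card A1 + 2 * r1 = 8 \<and> r1 \<le> (\<Sum>i<20. f i div 2)"
  proof -
    consider "odd (f 0)" | "odd (f 8)" | "even (f 0)" "even (f 8)" by blast
    then show ?thesis
    proof cases
      case 1
      then have "\<forall>i\<in>{..<8}. odd (f i)" using block0 by blast
      then show ?thesis by (intro exI[of _ "{..<8}"] exI[of _ 0]) (auto simp: block_start_def)
    next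
      case 2
      then have "\<forall>i\<in>{8..<16}. odd (f i)" using block8 by (meson atLeastLessThan_iff)
      then show ?thesis by (intro exI[of _ "{8..<16}"] exI[of _ 0]) (auto simp: block_start_def)
    next
      case 3
      have "16 \<le> i" if "odd (f i)" for i
        using block0[of i] block8[of i] 3 that by force
      then have "{i \<in> {..<20}. odd (f i)} \<subseteq> {16..<20}" by auto
      then have "card {i \<in> {..<20}. odd (f i)} \<le> 4"
        using card_mono[of "{16..<20::nat}"] by fastforce
      then have "4 \<le> (\<Sum>i<20. f i div 2)"
        using twice_sum_div2[of "{..<20}" f] sums k by simp
      then show ?thesis by (intro exI[of _ "{}"] exI[of _ 4]) auto
    qed
  qed
  then obtain A1 r1 where 1: "A1 \<subseteq> {..<20}" "\<forall>i\<in>A1. odd (f i)" "\<forall>i<30. block_start i \<in> A1 \<longleftrightarrow> i \<in> A1"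
     "card A1 + 2 * r1 = 8" "r1 \<le> (\<Sum>i<20. f i div 2)" by blast
  have "\<exists>A2 r2. A2 \<subseteq> {20..<30} \<and> (\<forall>i\<in>A2. odd (f i)) \<and> (\<forall>i<30. block_start i \<in> A2 \<longleftrightarrow> i \<in> A2) \<and>
     card A2 + 2 * r2 = 8 \<and> r2 \<le> (\<Sum>i=20..<30. f i div 2)"
  proof (cases "odd (f 24)")
    case True
    have "card {i \<in> {20..<30}. odd (f i)} \<le> 10"
      using card_mono[of "{20..<30::nat}" "{i \<in> {20..<30}. odd (f i)}"] by fastforce
    then have "1 \<le> (\<Sum>i=20..<30. f i div 2)"
      using twice_sum_div2[of "{20..<30}" f] sums k by simp
    moreover have "\<forall>i\<in>{24..<30}. odd (f i)"
      using block24 True by (meson atLeastLessThan_iff)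
    ultimately show ?thesis
      by (intro exI[of _ "{24..<30}"] exI[of _ 1]) (auto simp: block_start_def)
  next
    case False
    have "i < 24" if "odd (f i)" "i < 30" for i
      using block24[of i] False that by force
    then have "{i \<in> {20..<30}. odd (f i)} \<subseteq> {20..<24}" by auto
    then have "card {i \<in> {20..<30}. odd (f i)} \<le> 4"
      using card_mono[of "{20..<24::nat}"] by fastforce
    then have "4 \<le> (\<Sum>i=20..<30. f i div 2)"
      using twice_sum_div2[of "{20..<30}" f] sums k by simp
    then show ?thesis by (intro exI[of _ "{}"] exI[of _ 4]) auto
  qed
  then obtain A2 r2 where 2: "A2 \<subseteq> {20..<30}" "\<forall>i\<in>A2. odd (f i)" "\<forall>i<30. block_start i \<in> A2 \<longleftrightarrow> i \<in> A2"
     "card A2 + 2 * r2 = 8" "r2 \<le> (\<Sum>i=20..<30. f i div 2)" by blast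
  have "(A1 \<union> A2) \<inter> {..<20} = A1" "(A1 \<union> A2) \<inter> {20..<30} = A2"
    using 1(1) 2(1) by force+
  then show ?thesis
    using 1 2 by (intro parity_vectors_split[OF f, of "A1 \<union> A2" r1 _ r2]) auto
qed

text \<open>At most 20 entries of each component are odd, so at least \<open>(4n - 20) / 2 \<ge> n\<close> vertices are
  available, and no block has to be split off.\<close>

lemma parity_vectors_split_large:
  assumes f: "f \<in> parity_vectors k" and k: "2 * n \<le> k" "10 \<le> n"
  shows "\<exists>g \<in> parity_vectors n. (\<lambda>i. f i - g i) \<in> parity_vectors (k - n) \<and> (\<forall>i. g i \<le> f i)"
proof (rule parity_vectors_split[OF f, of "{}" n n n])
  have sums: "(\<Sum>i<20. f i) = 2 * k" "(\<Sum>i=20..<30. f i) = 2 * k"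
    using f by (simp_all add: parity_vectors_def)
  have "card {i \<in> {..<20}. odd (f i)} \<le> 20"
    using card_mono[of "{..<20::nat}" "{i \<in> {..<20}. odd (f i)}"] by fastforce
  then show "n \<le> (\<Sum>i<20. f i div 2)"
    using twice_sum_div2[of "{..<20}" f] sums k by simp
  have "card {i \<in> {20..<30}. odd (f i)} \<le> 10"
    using card_mono[of "{20..<30::nat}" "{i \<in> {20..<30}. odd (f i)}"] by fastforce
  then show "n \<le> (\<Sum>i=20..<30. f i div 2)"
    using twice_sum_div2[of "{20..<30}" f] sums k by simp
qed auto

lemma level_split:
  assumes "\<And>f. f \<in> parity_vectors k \<Longrightarrow>
             \<exists>g \<in> parity_vectors d. (\<lambda>i. f i - g i) \<in> parity_vectors (k - d) \<and> (\<forall>i. g i \<le> f i)"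
    and x: "x \<in> level parity_lattice simplex_product k"
  shows "\<exists>y \<in> level parity_lattice simplex_product d. x - y \<in> level parity_lattice simplex_product (k - d)"
proof -
  obtain f where f: "f \<in> parity_vectors k" "x = of_coords (\<lambda>i. real (f i))"
    using x by (auto simp: level_simplex_product)
  then obtain g where g: "g \<in> parity_vectors d" "(\<lambda>i. f i - g i) \<in> parity_vectors (k - d)" "\<forall>i. g i \<le> f i"
    using assms(1) by blast
  have "of_coords (\<lambda>i. real (g i)) + of_coords (\<lambda>i. real (f i - g i)) = x"
    using g(3) by (simp add: f(2) of_coords_add of_nat_diff)
  then have "x - of_coords (\<lambda>i. real (g i)) = of_coords (\<lambda>i. real (f i - g i))"
    by (simp add: algebra_simps flip: \<open>_ = x\<close>)
  then show ?thesis
    using g(1,2) by (auto simp: level_simplex_product)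
qed

lemma normal_dilate_4: "normal_polytope parity_lattice (dilate 4 simplex_product)"
  by (rule normal_dilateI, rule level_split) (use parity_vectors_split_4 in auto)

lemma normal_dilate_large:
  assumes "10 \<le> n"
  shows "normal_polytope parity_lattice (dilate n simplex_product)"
  by (rule normal_dilateI, rule level_split) (use parity_vectors_split_large assms in auto)

section \<open>Obstructions in degree five\<close>

lemma sum_first: "(\<Sum>i<20. f i) = (\<Sum>i<8. f i) + (\<Sum>i=8..<16. f i) + (\<Sum>i=16..<20. f i)"
  and sum_second: "(\<Sum>i=20..<30. f i) = (\<Sum>i=20..<24. f i) + (\<Sum>i=24..<30. f i)"
  for f :: "nat \<Rightarrow> nat"
  using sum.atLeastLessThan_concat[of 0 8 16 f] sum.atLeastLessThan_concat[of 0 16 20 f]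
    sum.atLeastLessThan_concat[of 20 24 30 f]
  by (simp_all add: lessThan_atLeast0)

text \<open>The first component of the witness is the all-ones vector, whose summands are constant with
  value 0 or 1 on every block, so that their coordinate sums are multiples of 4. A summand of degree 5
  would have coordinate sum 10. The second component can be any lattice point of degree 10.\<close>

lemma not_normal_dilate_5: "\<not> normal_polytope parity_lattice (dilate 5 simplex_product)"
proof
  assume normal: "normal_polytope parity_lattice (dilate 5 simplex_product)"
  define f :: "nat \<Rightarrow> nat" where "f i = (if i < 20 then 1 else if i = 20 then 20 else 0)" for i
  have "f \<in> parity_vectors (2 * 5)"
    by (auto simp: parity_vectors_def f_def block_start_def)
  then have "of_coords (\<lambda>i. real (f i)) \<in> level parity_lattice simplex_product (2 * 5)"
    by (auto simp: level_simplex_product)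
  then obtain y where y: "\<forall>i<2::nat. y i \<in> level parity_lattice simplex_product 5"
      "of_coords (\<lambda>i. real (f i)) = (\<Sum>i<2. y i)"
    using normal unfolding normal_dilate_iff by (meson zero_less_numeral)
  obtain g h where g: "g \<in> parity_vectors 5" "y 0 = of_coords (\<lambda>i. real (g i))"
    and h: "y 1 = of_coords (\<lambda>i. real (h i))"
    using y(1)[rule_format, of 0] y(1)[rule_format, of 1] by (auto simp: level_simplex_product)
  have "of_coords (\<lambda>i. real (f i)) = of_coords (\<lambda>i. real (g i + h i))"
    using y(2) g h by (simp add: numeral_2_eq_2 of_coords_add)
  then have le1: "g i \<le> 1" if "i < 20" for i
    using that unfolding of_coords_eq_iff of_nat_eq_iff by (auto simp: f_def dest: spec[of _ i])
  have gl: "g i = g (block_start i)" if "i < 20" for i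
  proof -
    have "even (g i) = even (g (block_start i))" using g(1) that by (simp add: parity_vectors_def)
    moreover have "block_start i < 20" using that by (simp add: block_start_def)
    ultimately show ?thesis using le1[OF that] le1[of "block_start i"] by (auto simp: le_Suc_eq)
  qed
  have "g i = g 0" if "i < 8" for i
    using gl[of i] that by (simp add: block_start_def)
  then have 1: "(\<Sum>i<8. g i) = (\<Sum>i<8::nat. g 0)"
    by (meson sum.cong lessThan_iff atLeastLessThan_iff)
  have "g i = g 8" if "8 \<le> i" "i < 16" for i
    using gl[of i] that by (simp add: block_start_def)
  then have 2: "(\<Sum>i=8..<16. g i) = (\<Sum>i=8..<16::nat. g 8)"
    by (meson sum.cong lessThan_iff atLeastLessThan_iff)
  have "g i = g 16" if "16 \<le> i" "i < 20" for i
    using gl[of i] that by (simp add: block_start_def)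
  then have 3: "(\<Sum>i=16..<20. g i) = (\<Sum>i=16..<20::nat. g 16)"
    by (meson sum.cong lessThan_iff atLeastLessThan_iff)
  have "(\<Sum>i<8. g i) + (\<Sum>i=8..<16. g i) + (\<Sum>i=16..<20. g i) = 10"
    using g(1) by (simp add: parity_vectors_def sum_first)
  then have "8 * g 0 + 8 * g 8 + 4 * g 16 = 10"
    unfolding 1 2 3 by simp
  then show False by presburger
qed

text \<open>The vector \<open>f\<close> is the all-ones vector of the first block plus the vertex \<open>2e\<^sub>0\<close> in the first factor, and
  the all-ones vector in the second. The second factor restricts the degree of a summand to
  0, 2, 3, 5. In the first factor, a summand that is even on the first block is at most \<open>2e\<^sub>0\<close>, and
  one that is odd contains the whole block; this excludes the degrees 2 and 3.\<close>

lemma degree_of_summand: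
  assumes f: "\<And>i. f i = (if i = 0 then 3 else if i < 8 then 1 else if i < 20 then 0 else (1::nat))"
    and g: "g \<in> parity_vectors a" and le: "\<forall>i<30. g i \<le> f i"
  shows "a = 0 \<or> a = 5"
proof -
  have par: "even (g i) = even (g (block_start i))" if "i < 30" for i
    using g that by (simp add: parity_vectors_def)
  have sums: "(\<Sum>i<20. g i) = 2 * a" "(\<Sum>i=20..<30. g i) = 2 * a"
    using g by (simp_all add: parity_vectors_def)
  have le1: "g i \<le> 1" if "0 < i" "i < 30" for i
    using le[rule_format, of i] that by (auto simp: f split: if_splits)
  have gl: "g i = g (block_start i)" if "20 \<le> i" "i < 30" for i
    using par[OF that(2)] le1[of i] le1[of "block_start i"] that by (auto simp: block_start_def le_Suc_eq)
  have "g i = g 20" if "20 \<le> i" "i < 24" for i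
    using gl[of i] that by (simp add: block_start_def)
  then have 1: "(\<Sum>i=20..<24. g i) = (\<Sum>i=20..<24::nat. g 20)"
    by (meson sum.cong lessThan_iff atLeastLessThan_iff)
  have "g i = g 24" if "24 \<le> i" "i < 30" for i
    using gl[of i] that by (simp add: block_start_def)
  then have 2: "(\<Sum>i=24..<30. g i) = (\<Sum>i=24..<30::nat. g 24)"
    by (meson sum.cong lessThan_iff atLeastLessThan_iff)
  then have "4 * g 20 + 6 * g 24 = 2 * a"
    using sums(2) unfolding sum_second 1 2 by simp
  then have a2: "a \<in> {0, 2, 3, 5}"
    using le1[of 20] le1[of 24] by (auto simp: le_Suc_eq)
  have z: "g i = 0" if "8 \<le> i" "i < 20" for i
    using le[rule_format, of i] that by (simp add: f)
  have s: "(\<Sum>i<8. g i) = 2 * a"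
    using sums(1) z by (simp add: sum_first)
  have s': "(\<Sum>i<8. g i) = g 0 + (\<Sum>i=1..<8. g i)"
    by (simp add: lessThan_atLeast0 sum.atLeast_Suc_lessThan)
  show ?thesis
  proof (cases "even (g 0)")
    case True
    have "g i = 0" if "i \<in> {1..<8}" for i
      using True par[of i] le1[of i] that by (auto simp: block_start_def le_Suc_eq)
    then have "2 * a = g 0" using s s' by simp
    then show ?thesis
      using a2 True le[rule_format, of 0] by (auto simp: f)
  next
    case False
    have "g i = 1" if "i \<in> {1..<8}" for i
      using False par[of i] le1[of i] that by (auto simp: block_start_def le_Suc_eq)
    then have "2 * a = g 0 + 7" using s s' by simp
    then show ?thesis
      using a2 odd_pos[OF False] by auto
  qed
qed

lemma level_simplex_product_0: "level parity_lattice simplex_product 0 = {0}"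
proof -
  have "simplex_product \<noteq> {}"
    by (rule simplex_product_nonempty)
  moreover have "0 \<in> parity_lattice"
    unfolding parity_lattice_def
    by (rule CollectI, rule exI[of _ "\<lambda>_. 0"]) (simp add: of_coords_def)
  ultimately show ?thesis by (auto simp: level_def dilate_def)
qed

lemma level_simplex_product_add:
  assumes "x \<in> level parity_lattice simplex_product k" "y \<in> level parity_lattice simplex_product l"
  shows "x + y \<in> level parity_lattice simplex_product (k + l)"
proof -
  obtain f g where f: "f \<in> parity_vectors k" "x = of_coords (\<lambda>i. real (f i))"
    and g: "g \<in> parity_vectors l" "y = of_coords (\<lambda>i. real (g i))"
    using assms by (auto simp: level_simplex_product)
  have "(\<lambda>i. f i + g i) \<in> parity_vectors (k + l)"
    using f g by (auto simp: parity_vectors_def sum.distrib)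
  then have "of_coords (\<lambda>i. real (f i + g i)) \<in> level parity_lattice simplex_product (k + l)"
    by (rule of_coords_mem_level)
  moreover have "x + y = of_coords (\<lambda>i. real (f i + g i))"
    by (simp add: f g of_coords_add)
  ultimately show ?thesis by metis
qed

lemma hilbert_basis_simplex_product:
  "hilbert_basis parity_lattice simplex_product = irreducibles (cone_semigroup parity_lattice simplex_product)"
proof (rule hilbert_basis_eq_irreducibles)
  show "additive_submonoid (cone_semigroup parity_lattice simplex_product)" (is "additive_submonoid ?S")
    unfolding additive_submonoid_def
  proof (intro conjI ballI)
    show "0 \<in> ?S"
      by (simp add: zero_prod_def mem_cone_semigroup_iff level_simplex_product_0)
    show "p + q \<in> ?S" if pq: "p \<in> ?S" "q \<in> ?S" for p q
    proof -
      obtain a x where p: "p = (int a, x)" "x \<in> level parity_lattice simplex_product a"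
        using pq(1) by (auto simp: cone_semigroup_eq)
      obtain b y where q: "q = (int b, y)" "y \<in> level parity_lattice simplex_product b"
        using pq(2) by (auto simp: cone_semigroup_eq)
      show ?thesis
        using level_simplex_product_add[OF p(2) q(2)]
        by (auto simp: p(1) q(1) mem_cone_semigroup_iff intro!: exI[of _ "a + b"])
    qed
  qed
  show "0 \<le> k \<and> (k = 0 \<longrightarrow> x = 0)" if kx: "(k, x) \<in> cone_semigroup parity_lattice simplex_product"
    for k x
  proof -
    obtain n where n: "k = int n" "x \<in> level parity_lattice simplex_product n"
      using kx unfolding mem_cone_semigroup_iff by blast
    have "x = 0" if "n = 0"
      using n(2) level_simplex_product_0 unfolding that by blast
    then show ?thesis by (simp add: n(1))
  qed
qed

lemma mu_Hilb_simplex_product: "mu_Hilb parity_lattice simplex_product = 5"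
proof -
  let ?S = "cone_semigroup parity_lattice simplex_product"
  have upper: "k \<in> {0..5}" if irr: "(k, x) \<in> irreducibles ?S" for k x
  proof -
    obtain n where n: "k = int n" "x \<in> level parity_lattice simplex_product n"
      using irr by (auto simp: irreducibles_def mem_cone_semigroup_iff)
    have "n \<le> 5"
    proof (rule ccontr)
      assume "\<not> n \<le> 5"
      then obtain y where y: "y \<in> level parity_lattice simplex_product 4" "x - y \<in> level parity_lattice simplex_product (n - 4)"
        using level_split[OF parity_vectors_split_4 n(2)] by auto
      have "(4, y) \<in> ?S"
        using y(1) by (auto simp: mem_cone_semigroup_iff intro!: exI[of _ 4])
      moreover have "(int n - 4, x - y) \<in> ?S"
        using y(2) \<open>\<not> n \<le> 5\<close> by (auto simp: mem_cone_semigroup_iff intro!: exI[of _ "n - 4"])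
      moreover have "(k, x) = (4, y) + (int n - 4, x - y)" by (simp add: n)
      ultimately show False
        using irr \<open>\<not> n \<le> 5\<close> unfolding irreducibles_def by (fastforce simp: zero_prod_def)
    qed
    then show ?thesis by (simp add: n)
  qed
  define f :: "nat \<Rightarrow> nat"
    where "f i = (if i = 0 then 3 else if i < 8 then 1 else if i < 20 then 0 else 1)" for i
  have "(\<Sum>i<20. f i) = 10"
    by (simp add: sum_first) (simp add: f_def lessThan_nat_numeral lessThan_Suc)
  moreover have "(\<Sum>i=20..<30. f i) = 10" by (simp add: f_def)
  moreover have "even (f i) = even (f (block_start i))" for i by (simp add: f_def block_start_def)
  ultimately have "f \<in> parity_vectors 5" by (simp add: parity_vectors_def)
  then have mem: "(5, of_coords (\<lambda>i. real (f i))) \<in> ?S"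
    using of_coords_mem_level by (auto simp: mem_cone_semigroup_iff intro!: exI[of _ 5])
  have "(5, of_coords (\<lambda>i. real (f i))) \<in> irreducibles ?S"
    unfolding irreducibles_def
  proof (intro CollectI conjI ballI impI mem)
    fix p q assume "p \<in> ?S" "q \<in> ?S" and eq: "(5, of_coords (\<lambda>i. real (f i))) = p + q"
    obtain a x where p: "p = (int a, x)" "x \<in> level parity_lattice simplex_product a"
      using \<open>p \<in> ?S\<close> unfolding cone_semigroup_eq by blast
    obtain b y where q: "q = (int b, y)" "y \<in> level parity_lattice simplex_product b"
      using \<open>q \<in> ?S\<close> unfolding cone_semigroup_eq by blast
    obtain g h where g: "g \<in> parity_vectors a" "x = of_coords (\<lambda>i. real (g i))"
      and h: "h \<in> parity_vectors b" "y = of_coords (\<lambda>i. real (h i))"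
      using p q by (auto simp: level_simplex_product)
    have "of_coords (\<lambda>i. real (f i)) = of_coords (\<lambda>i. real (g i + h i))"
      using eq p q g h by (simp add: of_coords_add)
    then have "\<forall>i<30. g i \<le> f i"
      unfolding of_coords_eq_iff of_nat_eq_iff by simp
    then have "a = 0 \<or> a = 5"
      using degree_of_summand[OF f_def g(1)] by blast
    moreover have "a + b = 5" using eq p q by simp
    ultimately have "a = 0 \<or> b = 0" by auto
    then show "p = 0 \<or> q = 0"
      using p q level_simplex_product_0 by (auto simp: zero_prod_def)
  qed (simp add: zero_prod_def)
  then have "5 \<in> fst ` irreducibles ?S" by force
  moreover have "fst ` irreducibles ?S \<subseteq> {0..5}" using upper by force
  ultimately show ?thesis
    unfolding mu_Hilb_def hilbert_basis_simplex_product
    by (meson Max_eqI atLeastAtMost_iff finite_atLeastAtMost_int finite_subset subsetD)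
qed

theorem mainTheorem9:
  shows "\<exists>(M :: (nat \<Rightarrow>\<^sub>0 real) set) P.
           is_lattice M \<and> lattice_polytope M P \<and>
           int (mu_midp M P) < mu_Hilb M P \<and> mu_Hilb M P < int (mu_idp M P)"
proof (intro exI conjI)
  have "mu_midp parity_lattice simplex_product \<le> 4"
    unfolding mu_midp_def by (rule Least_le) (simp add: normal_dilate_4)
  then show "int (mu_midp parity_lattice simplex_product) < mu_Hilb parity_lattice simplex_product"
    by (simp add: mu_Hilb_simplex_product)
  let ?Q = "\<lambda>N. N > 0 \<and> (\<forall>n\<ge>N. normal_polytope parity_lattice (dilate n simplex_product))"
  have "?Q 10" using normal_dilate_large by simp
  then have "?Q (mu_idp parity_lattice simplex_product)"
    unfolding mu_idp_def by (rule LeastI)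
  then have "5 < mu_idp parity_lattice simplex_product"
    using not_normal_dilate_5 by (meson not_le)
  then show "mu_Hilb parity_lattice simplex_product < int (mu_idp parity_lattice simplex_product)"
    by (simp add: mu_Hilb_simplex_product)
qed (rule is_lattice_parity_lattice lattice_polytope_simplex_product)+

end
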